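(* There exists an absolute constant $C>0$ such that the following holds. Let $0<p\le 1/2$, $0<q<1$ and $n\in\mathbb{N}$ satisfy $n\ge 200(pqn)^3$, $n\ge 8p(qn)^2$ and $pqn\ge 32\log\frac1p$. Let $\mathcal{H}$ be a hypergraph on vertex set $[n]$, and let $B$ be a $q$-subset of $[n]$. Then $$\mathrm{Var}_q\big(r_{\mathcal{H}}(B,p)\big)\;\le\; C\,p\Big(\log\frac1p\Big)^2 .$$ (In particular $C$ does not depend on $\mathcal{H}$.)
   Context: $[n]=\{1,\dots,n\}$. A hypergraph $\mathcal{H}$ on vertex set $[n]$ is an arbitrary collection of subsets of $[n]$ (not necessarily of equal sizes). For $s\in(0,1)$, an $s$-subset of a set $S$ is a random subset of $S$ obtained by including each element independently with probability $s$. For $B\subset[n]$ and $p\in(0,1)$, $r_{\mathcal{H}}(B,p)$ denotes the probability that $A\in\mathcal{H}$, where $A$ is a $p$-subset of $B$. $\mathrm{Var}_q$ denotes the variance with respect to the random choice of the $q$-subset $B$ of $[n]$. *)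

theory Defs
  imports "HOL-Probability.Probability"
begin

text \<open>Meaningful for finite \<open>S\<close> and \<open>0 \<le> s \<le> 1\<close>.\<close>

definition random_subset :: "'a set \<Rightarrow> real \<Rightarrow> 'a set pmf" where
  "random_subset S s = map_pmf (\<lambda>b. {x \<in> S. b x}) (Pi_pmf S False (\<lambda>_. bernoulli_pmf s))"

text \<open>This is the paper's \<open>r\<^sub>H(B, p)\<close>.\<close>

definition hit_prob :: "'a set set \<Rightarrow> 'a set \<Rightarrow> real \<Rightarrow> real" where
  "hit_prob H B p = measure_pmf.prob (random_subset B p) {A. A \<in> H}"

end

theory Submission
  imports Defs
begin

text \<open>
  If \<open>A\<close> is a \<open>p\<close>-subset of a \<open>q\<close>-subset \<open>B\<close>, then for a single vertex the indicators of
  membership in \<open>A\<close> and in \<open>B\<close> have squared maximal correlation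
  \<open>p (1 - q) / (1 - p q) \<le> p\<close>. Squared maximal correlation tensorises over the independent
  vertices, so the variance of the conditional expectation of \<open>f A\<close> given \<open>B\<close> is at most \<open>p\<close>
  times the variance of \<open>f A\<close>. For an indicator \<open>f\<close> this gives the bound \<open>p / 4\<close>, and
  \<open>ln (1 / p) \<ge> 1 - p \<ge> 1 / 2\<close>.
\<close>

abbreviation (input) subset_expectation :: "real \<Rightarrow> 'a set \<Rightarrow> ('a set \<Rightarrow> real) \<Rightarrow> real" where
  "subset_expectation s S f \<equiv> measure_pmf.expectation (random_subset S s) f"

lemma set_pmf_random_subset: "set_pmf (random_subset S s) \<subseteq> Pow S"
  by (auto simp: random_subset_def)

lemma integrable_random_subset:
  fixes f :: "'a set \<Rightarrow> real"
  assumes "finite S"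
  shows "integrable (measure_pmf (random_subset S s)) f"
  using assms by (intro integrable_measure_pmf_finite finite_subset[OF set_pmf_random_subset]) simp

lemma subset_expectation_cong:
  assumes "\<And>A. A \<subseteq> S \<Longrightarrow> f A = g A"
  shows "subset_expectation s S f = subset_expectation s S g"
  using assms set_pmf_random_subset[of S s]
  by (intro integral_cong_AE) (auto simp: AE_measure_pmf_iff)

lemma subset_expectation_mono:
  assumes "finite S" and "\<And>A. A \<subseteq> S \<Longrightarrow> f A \<le> g A"
  shows "subset_expectation s S f \<le> subset_expectation s S g"
  using assms set_pmf_random_subset[of S s]
  by (intro integral_mono_AE integrable_random_subset) (auto simp: AE_measure_pmf_iff)

lemma subset_expectation_linear:
  assumes "finite S"
  shows "subset_expectation s S (\<lambda>A. a * f A + b * g A) =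
    a * subset_expectation s S f + b * subset_expectation s S g"
  using assms by (simp add: integrable_random_subset)

text \<open>The coin of \<open>x\<close> is independent of the coins on \<open>S\<close>, so it may
  be tossed first. Updating the choice function at \<open>x\<close> leaves the part chosen from
  \<open>S\<close> unchanged because \<open>x\<close> lies outside \<open>S\<close>.\<close>

lemma random_subset_insert:
  assumes "finite S" "x \<notin> S"
  shows "random_subset (insert x S) s =
    bernoulli_pmf s \<bind> (\<lambda>b. map_pmf (if b then insert x else id) (random_subset S s))"
proof -
  have "{y \<in> insert x S. (h(x := b)) y} = (if b then insert x else id) {y \<in> S. h y}" for h b
    using assms(2) by auto
  then show ?thesis
    using assms
    by (simp add: random_subset_def Pi_pmf_insert' map_bind_pmf pmf.map_comp o_def
        flip: map_pmf_def)
qed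

lemma subset_expectation_insert:
  assumes "finite S" "x \<notin> S" "0 \<le> s" "s \<le> 1"
  shows "subset_expectation s (insert x S) f =
    (1 - s) * subset_expectation s S f + s * subset_expectation s S (\<lambda>A. f (insert x A))"
proof -
  have "finite (set_pmf (random_subset S s))"
    using assms(1) by (intro finite_subset[OF set_pmf_random_subset]) simp
  then show ?thesis
    unfolding random_subset_insert[OF assms(1,2)]
    by (subst pmf_expectation_bind[where A = UNIV]) (use assms in \<open>auto simp: UNIV_bool\<close>)
qed

lemma subset_expectation_square_le:
  assumes "finite S"
  shows "(subset_expectation s S f)\<^sup>2 \<le> subset_expectation s S (\<lambda>A. (f A)\<^sup>2)"
  using measure_pmf.variance_positive[of "random_subset S s" f]
    measure_pmf.variance_eq[OF integrable_random_subset[OF assms] integrable_random_subset[OF assms], of s f]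
  by simp

text \<open>The vertex \<open>x\<close> survives both selections with probability
  \<open>p * q\<close>, independently of the rest, so it can be integrated out by averaging
  \<open>f\<close> over its membership. The induction below uses this for \<open>f\<close> and for
  its square.\<close>

lemma nested_subset_expectation_insert:
  assumes "finite S" "x \<notin> S" "0 \<le> p" "p \<le> 1" "0 \<le> q" "q \<le> 1"
  shows "subset_expectation q (insert x S) (\<lambda>B. subset_expectation p B f) =
    subset_expectation q S (\<lambda>B. subset_expectation p B
      (\<lambda>A. (1 - p * q) * f A + p * q * f (insert x A)))"
proof -
  let ?f1 = "\<lambda>A. f (insert x A)"
  let ?M = "\<lambda>f. subset_expectation q S (\<lambda>B. subset_expectation p B f)"
  have "subset_expectation q S (\<lambda>B. subset_expectation p (insert x B) f) =
    subset_expectation q S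
      (\<lambda>B. (1 - p) * subset_expectation p B f + p * subset_expectation p B ?f1)"
    using assms by (intro subset_expectation_cong subset_expectation_insert) (auto intro: finite_subset)
  also have "\<dots> = (1 - p) * ?M f + p * ?M ?f1"
    using assms(1) by (rule subset_expectation_linear)
  finally have ins: "subset_expectation q S (\<lambda>B. subset_expectation p (insert x B) f) = \<dots>" .
  have "?M (\<lambda>A. (1 - p * q) * f A + p * q * f (insert x A)) = subset_expectation q S
      (\<lambda>B. (1 - p * q) * subset_expectation p B f + p * q * subset_expectation p B ?f1)"
    using assms(1) by (intro subset_expectation_cong subset_expectation_linear) (auto intro: finite_subset)
  also have "\<dots> = (1 - p * q) * ?M f + p * q * ?M ?f1"
    using assms(1) by (rule subset_expectation_linear)
  finally show ?thesis
    using assms by (simp add: subset_expectation_insert ins algebra_simps)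
qed

text \<open>Subtracting the squared mean from both sides turns this into: the variance of the
  conditional expectation given \<open>B\<close> is at most \<open>p\<close> times the variance of
  \<open>f A\<close>. Induction on \<open>S\<close> needs \<open>f\<close> arbitrary, since the
  hypothesis is applied to \<open>f\<close> averaged over the new vertex.\<close>

lemma nested_subset_expectation_contraction:
  assumes "finite S" "0 \<le> p" "p \<le> 1" "0 \<le> q" "q \<le> 1"
  shows "subset_expectation q S (\<lambda>B. (subset_expectation p B f)\<^sup>2) \<le>
    (1 - p) * (subset_expectation q S (\<lambda>B. subset_expectation p B f))\<^sup>2 +
    p * subset_expectation q S (\<lambda>B. subset_expectation p B (\<lambda>A. (f A)\<^sup>2))"
  using assms(1)
proof (induction S arbitrary: f rule: finite_induct)
  case empty
  have "random_subset ({} :: 'a set) s = return_pmf {}" for s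
    by (simp add: random_subset_def)
  then show ?case
    by (simp add: algebra_simps)
next
  case (insert x S)
  let ?M = "\<lambda>f. subset_expectation q S (\<lambda>B. subset_expectation p B f)"
  let ?Q = "\<lambda>f. subset_expectation q S (\<lambda>B. (subset_expectation p B f)\<^sup>2)"
  \<comment> \<open>\<open>g\<close> is the mean of \<open>f\<close> over the membership of
    \<open>x\<close> in \<open>A\<close>, and \<open>h\<close> is the discrete derivative of
    \<open>f\<close> at \<open>x\<close>.\<close>
  define g where "g = (\<lambda>A. (1 - p * q) * f A + p * q * f (insert x A))"
  define h where "h = (\<lambda>A. f (insert x A) - f A)"
  have fin: "finite B" if "B \<subseteq> S" for B
    using that insert.hyps(1) by (rule finite_subset)
  \<comment> \<open>Second moment equals squared mean plus variance, for the two values taken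
    according to whether \<open>x\<close> is in the \<open>q\<close>-subset. These values differ by
    \<open>p\<close> times the expectation of \<open>h\<close>, whence the factor
    \<open>p\<^sup>2 * q * (1 - q)\<close>.\<close>
  have point: "(1 - q) * (subset_expectation p B f)\<^sup>2 + q * (subset_expectation p (insert x B) f)\<^sup>2 =
      (subset_expectation p B g)\<^sup>2 + p\<^sup>2 * q * (1 - q) * (subset_expectation p B h)\<^sup>2"
    if "B \<subseteq> S" for B
  proof -
    have g: "subset_expectation p B g =
        (1 - p * q) * subset_expectation p B f + p * q * subset_expectation p B (\<lambda>A. f (insert x A))"
      unfolding g_def using fin[OF that] by (rule subset_expectation_linear)
    have h: "subset_expectation p B h =
        subset_expectation p B (\<lambda>A. f (insert x A)) - subset_expectation p B f"
      unfolding h_def using fin[OF that] by (simp add: integrable_random_subset)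
    have ins: "subset_expectation p (insert x B) f =
        (1 - p) * subset_expectation p B f + p * subset_expectation p B (\<lambda>A. f (insert x A))"
      using that fin[OF that] insert.hyps(2) assms by (intro subset_expectation_insert) auto
    show ?thesis
      unfolding g h ins by algebra
  qed
  have "subset_expectation q (insert x S) (\<lambda>B. (subset_expectation p B f)\<^sup>2) =
      subset_expectation q S (\<lambda>B. (1 - q) * (subset_expectation p B f)\<^sup>2 +
        q * (subset_expectation p (insert x B) f)\<^sup>2)"
    using insert.hyps assms by (simp add: subset_expectation_insert subset_expectation_linear)
  \<comment> \<open>The factor \<open>1\<close> gives the integrand the shape required by
    \<open>subset_expectation_linear\<close>.\<close>
  also have "\<dots> = subset_expectation q S (\<lambda>B. 1 * (subset_expectation p B g)\<^sup>2 +
      p\<^sup>2 * q * (1 - q) * (subset_expectation p B h)\<^sup>2)"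
    by (intro subset_expectation_cong) (simp add: point)
  also have "\<dots> = ?Q g + p\<^sup>2 * q * (1 - q) * ?Q h"
    using insert.hyps(1) by (subst subset_expectation_linear) simp_all
  \<comment> \<open>The induction hypothesis handles \<open>g\<close>, and Jensen's inequality
    handles \<open>h\<close>. Since \<open>p * q \<le> q\<close>, the coefficient is at most
    \<open>p\<close> times the variance \<open>p * q * (1 - p * q)\<close> of the indicator that
    \<open>x\<close> is in \<open>A\<close>; this is the one-vertex contraction.\<close>
  also have "\<dots> \<le> ((1 - p) * (?M g)\<^sup>2 + p * ?M (\<lambda>A. (g A)\<^sup>2)) +
      p * (p * q * (1 - p * q)) * ?M (\<lambda>A. (h A)\<^sup>2)"
  proof (rule add_mono[OF insert.IH mult_mono])
    show "?Q h \<le> ?M (\<lambda>A. (h A)\<^sup>2)"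
      using insert.hyps(1) fin by (intro subset_expectation_mono subset_expectation_square_le)
    have "p * q \<le> q"
      using assms by (simp add: mult_left_le_one_le)
    then have "p * (p * q) * (1 - q) \<le> p * (p * q) * (1 - p * q)"
      using assms by (intro mult_left_mono) auto
    then show "p\<^sup>2 * q * (1 - q) \<le> p * (p * q * (1 - p * q))"
      by (simp add: power2_eq_square mult.assoc)
    have "p * q \<le> 1"
      using assms by (simp add: mult_le_one)
    then show "0 \<le> p * (p * q * (1 - p * q))"
      using assms by simp
  qed simp
  also have "\<dots> = (1 - p) * (?M g)\<^sup>2 +
      p * (1 * ?M (\<lambda>A. (g A)\<^sup>2) + p * q * (1 - p * q) * ?M (\<lambda>A. (h A)\<^sup>2))"
    by (simp add: algebra_simps)
  also have "1 * ?M (\<lambda>A. (g A)\<^sup>2) + p * q * (1 - p * q) * ?M (\<lambda>A. (h A)\<^sup>2) =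
      subset_expectation q S (\<lambda>B. 1 * subset_expectation p B (\<lambda>A. (g A)\<^sup>2) +
        p * q * (1 - p * q) * subset_expectation p B (\<lambda>A. (h A)\<^sup>2))"
    using insert.hyps(1) by (rule subset_expectation_linear[symmetric])
  also have "\<dots> = ?M (\<lambda>A. 1 * (g A)\<^sup>2 + p * q * (1 - p * q) * (h A)\<^sup>2)"
    using fin by (intro subset_expectation_cong subset_expectation_linear[symmetric])
  \<comment> \<open>Again squared mean plus variance, now for a coin of bias \<open>p * q\<close>:
    the terms in \<open>g\<close> and \<open>h\<close> recombine into the average of the square of
    \<open>f\<close> over \<open>x\<close>.\<close>
  also have "(\<lambda>A. 1 * (g A)\<^sup>2 + p * q * (1 - p * q) * (h A)\<^sup>2) =
      (\<lambda>A. (1 - p * q) * (f A)\<^sup>2 + p * q * (f (insert x A))\<^sup>2)"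
  proof
    show "1 * (g A)\<^sup>2 + p * q * (1 - p * q) * (h A)\<^sup>2 =
        (1 - p * q) * (f A)\<^sup>2 + p * q * (f (insert x A))\<^sup>2" for A
      unfolding g_def h_def by algebra
  qed
  finally show ?case
    using insert.hyps assms by (simp add: nested_subset_expectation_insert g_def)
qed

lemma variance_hit_prob_le:
  assumes "finite S" "0 \<le> p" "p \<le> 1" "0 \<le> q" "q \<le> 1"
  shows "measure_pmf.variance (random_subset S q) (\<lambda>B. hit_prob H B p) \<le> p / 4"
proof -
  define m where "m = subset_expectation q S (\<lambda>B. hit_prob H B p)"
  have hit: "hit_prob H B p = subset_expectation p B (indicator H)" for B
    by (simp add: hit_prob_def)
  have "measure_pmf.variance (random_subset S q) (\<lambda>B. hit_prob H B p) =
      subset_expectation q S (\<lambda>B. (hit_prob H B p)\<^sup>2) - m\<^sup>2"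
    unfolding m_def using assms(1) by (intro measure_pmf.variance_eq integrable_random_subset)
  \<comment> \<open>An indicator equals its square, so its second moment is \<open>m\<close> as
    well, and the bound is \<open>p * m * (1 - m)\<close>.\<close>
  also have "\<dots> \<le> (1 - p) * m\<^sup>2 + p * m - m\<^sup>2"
  proof -
    have "(\<lambda>A. (indicator H A)\<^sup>2) = (indicator H :: _ \<Rightarrow> real)"
      by (auto simp: indicator_def)
    then show ?thesis
      using nested_subset_expectation_contraction[OF assms, of "indicator H"]
      unfolding m_def hit by simp
  qed
  also have "\<dots> = p / 4 - p * (m - 1 / 2)\<^sup>2"
    by (simp add: power2_eq_square algebra_simps)
  also have "\<dots> \<le> p / 4"
    using assms(2) by simp
  finally show ?thesis .
qed

theorem theorem1p4:
  shows "\<exists>C::real. C > 0 \<and>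
    (\<forall>(p::real) (q::real) (n::nat) (H :: nat set set).
       0 < p \<longrightarrow> p \<le> 1/2 \<longrightarrow> 0 < q \<longrightarrow> q < 1 \<longrightarrow>
       real n \<ge> 200 * (p * q * real n) ^ 3 \<longrightarrow>
       real n \<ge> 8 * p * (q * real n) ^ 2 \<longrightarrow>
       p * q * real n \<ge> 32 * ln (1 / p) \<longrightarrow>
       H \<subseteq> Pow {1..n} \<longrightarrow>
       measure_pmf.variance (random_subset {1..n} q) (\<lambda>B. hit_prob H B p)
         \<le> C * p * (ln (1 / p)) ^ 2)"
proof (intro exI[of _ 1] conjI allI impI)
  fix p q :: real and n :: nat and H :: "nat set set"
  assume p: "0 < p" "p \<le> 1/2" and q: "0 < q" "q < 1"
  have "1 / 2 \<le> ln (1 / p)"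
    using p ln_le_minus_one[of p] by (simp add: ln_div)
  \<comment> \<open>Squaring the bound on the logarithm yields exactly the constant 1/4 of the
    variance bound, so the witness \<open>1\<close> suffices.\<close>
  then have "(1 / 2)\<^sup>2 \<le> (ln (1 / p))\<^sup>2"
    by (rule power_mono) simp
  then have "p * (1 / 4) \<le> p * (ln (1 / p))\<^sup>2"
    using p by (intro mult_left_mono) (simp_all add: power2_eq_square)
  moreover have "measure_pmf.variance (random_subset {1..n} q) (\<lambda>B. hit_prob H B p) \<le> p / 4"
    using p q by (intro variance_hit_prob_le) auto
  ultimately show "measure_pmf.variance (random_subset {1..n} q) (\<lambda>B. hit_prob H B p)
      \<le> 1 * p * (ln (1 / p)) ^ 2"
    by simp
qed simp

end
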